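(* For every Diophantine real number $\alpha$ and every $1$-periodic real analytic function $g:\mathbb{R}\to\mathbb{C}$ satisfying $\int_0^1 g(x)\,dx=0$, the function $$ \zeta_{g,\alpha}(s)=\sum_{n=1}^{\infty}\frac{g(n\alpha)}{n^s} $$ (defined by this absolutely convergent series for $\mathrm{Re}(s)>1$) has an analytic continuation to the entire complex plane.
   Context: A real number $\alpha$ is Diophantine of type $r$ (where $r>1$) if there exists $C>0$ such that $|\alpha-\frac{p}{q}|\ge \frac{C}{q^{1+r}}$ for all rational numbers $p/q$ (with $q\geq 1$); $\alpha$ is Diophantine if it is Diophantine of type $r$ for some $r>1$. *)

theory Defs
  imports "HOL-Analysis.Analysis"
begin

definition diophantine_type :: "real \<Rightarrow> real \<Rightarrow> bool" where
  "diophantine_type r \<alpha> \<longleftrightarrow> r > 1 \<and>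
     (\<exists>C>0. \<forall>(p::int) (q::nat). q \<ge> 1 \<longrightarrow>
        \<bar>\<alpha> - real_of_int p / real q\<bar> \<ge> C / real q powr (1 + r))"

definition diophantine :: "real \<Rightarrow> bool" where
  "diophantine \<alpha> \<longleftrightarrow> (\<exists>r>1. diophantine_type r \<alpha>)"

(* The library's analytic_on concerns functions on the complex plane, so real analyticity is
   spelled out: near every point the function is the sum of a power series. *)
definition real_analytic :: "(real \<Rightarrow> complex) \<Rightarrow> bool" where
  "real_analytic g \<longleftrightarrow>
     (\<forall>x0. \<exists>(a :: nat \<Rightarrow> complex) \<epsilon>. \<epsilon> > 0 \<and>
        (\<forall>x. \<bar>x - x0\<bar> < \<epsilon> \<longrightarrow> (\<lambda>k. a k * complex_of_real (x - x0) ^ k) sums g x))"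

definition zeta_term :: "(real \<Rightarrow> complex) \<Rightarrow> real \<Rightarrow> complex \<Rightarrow> nat \<Rightarrow> complex" where
  "zeta_term g \<alpha> s n = g (real n * \<alpha>) / of_nat n powr s"

(* The series starts at n = 1, hence the shift by Suc. The value is meaningful only
   where the series converges, in particular for Re s > 1 if g is bounded. *)
definition zeta_series :: "(real \<Rightarrow> complex) \<Rightarrow> real \<Rightarrow> complex \<Rightarrow> complex" where
  "zeta_series g \<alpha> s = (\<Sum>n. zeta_term g \<alpha> s (Suc n))"

end

theory Submission
  imports Defs "HOL-Complex_Analysis.Complex_Analysis"
begin

text \<open>
  Summation by parts shows that, for a bounded sequence \<open>w\<close>, the Dirichlet series whose coefficients
  are the \<open>k\<close>-th forward difference of \<open>w\<close> continues to the half-plane \<open>Re s > 1 - k\<close>, because the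
  \<open>k\<close>-th difference of \<open>n\<close> to the power \<open>- s\<close> is of order \<open>n\<close> to the power \<open>- Re s - k\<close>. It is therefore
  enough that \<open>g (n \<alpha>)\<close> is, for every \<open>k\<close>, a \<open>k\<close>-th difference of a bounded sequence. In the Fourier
  expansion of \<open>g\<close> this means dividing the coefficient of frequency \<open>m\<close> by the \<open>k\<close>-th power of
  \<open>exp (2 \<pi> i m \<alpha>) - 1\<close>. The Diophantine condition bounds these divisors below by a power of \<open>1 / m\<close>,
  while the coefficients of a smooth function decay faster than any power, so the series of quotients
  still converges absolutely; the coefficient at \<open>m = 0\<close> is the mean of \<open>g\<close> and vanishes.
\<close>

subsection \<open>Dirichlet series with difference coefficients\<close>

definition forward_diff :: "(nat \<Rightarrow> complex) \<Rightarrow> nat \<Rightarrow> complex" where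
  "forward_diff w n = w (Suc n) - w n"

text \<open>The argument ranges over the reals and not only over the naturals, so that each unit
  step can be estimated through a derivative.\<close>

primrec powr_diff :: "nat \<Rightarrow> complex \<Rightarrow> real \<Rightarrow> complex" where
  "powr_diff 0 s x = of_real x powr (- s)"
| "powr_diff (Suc k) s x = powr_diff k s (x + 1) - powr_diff k s x"

text \<open>For bounded \<open>w\<close> convergence is guaranteed only for \<open>Re s > 1 - k\<close>; elsewhere the value may be junk.\<close>
definition dirichlet :: "nat \<Rightarrow> (nat \<Rightarrow> complex) \<Rightarrow> complex \<Rightarrow> complex" where
  "dirichlet k w s = (\<Sum>n. w n * powr_diff k s (real (Suc n)))"

text \<open>Differencing commutes with differentiation, so the derivative stays in the same family
  with \<open>s\<close> raised by one.\<close>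

lemma powr_diff_has_vector_derivative:
  "x > 0 \<Longrightarrow> (powr_diff k s has_vector_derivative (- s * powr_diff k (s + 1) x)) (at x)"
proof (induction k arbitrary: x)
  case 0
  have "((\<lambda>z. z powr (- s)) has_field_derivative (- s * of_real x powr (- s - 1))) (at (of_real x))"
    using 0 by (intro has_field_derivative_powr) auto
  from has_vector_derivative_real_field[OF this] have
    "((\<lambda>x. of_real x powr (- s)) has_vector_derivative (- s * of_real x powr (- s - 1))) (at x)" .
  moreover have "powr_diff 0 s = (\<lambda>x. of_real x powr (- s))" by (rule ext) simp
  ultimately show ?case by simp
next
  case (Suc k)
  have shift: "((\<lambda>y. y + 1) has_vector_derivative 1) (at x)"
    by (auto intro!: derivative_eq_intros)
  have "(powr_diff k s has_vector_derivative (- s * powr_diff k (s + 1) (x + 1))) (at (x + 1))"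
    using Suc.prems by (intro Suc.IH) simp
  from vector_diff_chain_at[OF shift this]
  have "((\<lambda>y. powr_diff k s (y + 1)) has_vector_derivative (- s * powr_diff k (s + 1) (x + 1))) (at x)"
    by (simp add: o_def)
  from has_vector_derivative_diff[OF this Suc.IH[OF Suc.prems]] show ?case
    by (simp add: algebra_simps)
qed

text \<open>A unit step is bounded by the derivative on the interval, which is \<open>- s\<close>
  times a difference of one order less at \<open>s + 1\<close>. Each round gains one factor of the
  product and one power of \<open>1 / x\<close>; the sign condition makes the power of
  \<open>x\<close> largest at the left end point.\<close>

lemma norm_powr_diff_le:
  "x > 0 \<Longrightarrow> 0 \<le> Re s + real k \<Longrightarrow>
    norm (powr_diff k s x) \<le> (\<Prod>j<k. norm (s + of_nat j)) * x powr (- (Re s + real k))"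
proof (induction k arbitrary: s x)
  case 0
  then show ?case by (simp add: norm_powr_real_powr)
next
  case (Suc k)
  let ?P = "\<Prod>j<k. norm (s + 1 + of_nat j)"
  let ?B = "norm s * (?P * x powr (- (Re s + real (Suc k))))"
  have "norm (powr_diff k s (x + 1) - powr_diff k s x) \<le> ?B * norm ((x + 1) - x)"
  proof (rule differentiable_bound[of "{x..x+1}"])
    fix y assume y: "y \<in> {x..x+1}"
    then have "y > 0" using Suc.prems by auto
    then show "(powr_diff k s has_derivative (\<lambda>h. h *\<^sub>R (- s * powr_diff k (s + 1) y))) (at y within {x..x+1})"
      using powr_diff_has_vector_derivative[of y k s]
      by (auto simp: has_vector_derivative_def intro: has_derivative_at_withinI)
    have "norm (powr_diff k (s + 1) y) \<le> ?P * y powr (- (Re s + real (Suc k)))"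
      using Suc.IH[of y "s + 1"] \<open>y > 0\<close> Suc.prems by (simp add: algebra_simps)
    also have "\<dots> \<le> ?P * x powr (- (Re s + real (Suc k)))"
      using y Suc.prems by (intro mult_left_mono powr_mono2' prod_nonneg) auto
    finally have "norm (- s * powr_diff k (s + 1) y) \<le> ?B"
      by (simp add: norm_mult mult_left_mono)
    then show "onorm (\<lambda>h. h *\<^sub>R (- s * powr_diff k (s + 1) y)) \<le> ?B"
      by (intro onorm_le) (simp add: mult.commute mult_left_mono)
  qed auto
  moreover have "norm s * ?P = (\<Prod>j<Suc k. norm (s + of_nat j))"
    by (subst prod.lessThan_Suc_shift) (simp add: algebra_simps)
  ultimately show ?case by (simp add: mult.assoc[symmetric])
qed

lemma holomorphic_powr_diff: "(\<lambda>s. powr_diff k s x) holomorphic_on A"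
  by (induction k arbitrary: x) (auto intro!: holomorphic_intros)

lemma bounded_forward_diff_power:
  "bounded (range w) \<Longrightarrow> bounded (range ((forward_diff ^^ k) w))"
proof (induction k)
  case (Suc k)
  then obtain B where B: "\<And>n. norm ((forward_diff ^^ k) w n) \<le> B"
    by (auto simp: bounded_iff)
  have "norm ((forward_diff ^^ Suc k) w n) \<le> B + B" for n
    using norm_triangle_ineq4[of "(forward_diff ^^ k) w (Suc n)" "(forward_diff ^^ k) w n"] B[of n] B[of "Suc n"]
    by (simp add: forward_diff_def)
  then show ?case unfolding bounded_iff by blast
qed auto

lemma forward_diff_power_Suc_index: "(forward_diff ^^ k) w (Suc n) = (forward_diff ^^ k) (\<lambda>n. w (Suc n)) n"
  by (induction k arbitrary: n) (auto simp: forward_diff_def)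

lemma summable_Suc_powr: "c > 1 \<Longrightarrow> summable (\<lambda>n. real (Suc n) powr (- c))"
  using summable_real_powr_iff[of "- c"] summable_Suc_iff[of "\<lambda>n. real n powr (- c)"] by auto

text \<open>The Weierstrass M-test on small closed discs gives locally uniform convergence of the
  partial sums, which are entire. The same majorant, used at the centre of a disc, gives
  summability.\<close>

lemma dirichlet_holomorphic_summable:
  assumes w: "bounded (range w)"
  shows "dirichlet k w holomorphic_on {s. Re s > 1 - real k}" (is ?hol)
    and "Re s > 1 - real k \<Longrightarrow> summable (\<lambda>n. w n * powr_diff k s (real (Suc n)))"
proof -
  obtain B where B: "\<And>n. norm (w n) \<le> B" using w by (auto simp: bounded_iff)
  have B0: "B \<ge> 0" using B[of 0] norm_ge_zero[of "w 0"] by linarith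
  let ?f = "\<lambda>n s. w n * powr_diff k s (real (Suc n))"
  \<comment> \<open>Half the distance from \<open>x\<close> to the boundary line: on the disc of
    this radius \<open>Re s + real k\<close> exceeds 1 by at least \<open>d x\<close>, which makes
    the majorant \<open>M x\<close> summable.\<close>
  define d where "d x = (Re x - (1 - real k)) / 2" for x
  define M where
    "M x n = B * ((\<Prod>j<k. norm x + d x + real j) * real (Suc n) powr (- (1 + d x)))" for x n
  have bd: "norm (?f n s) \<le> M x n" if x: "Re x > 1 - real k" and s: "s \<in> cball x (d x)" for x s n
  proof -
    have d: "d x > 0" using x by (simp add: d_def)
    have sx: "norm (s - x) \<le> d x" using s by (simp add: dist_norm norm_minus_commute)
    have re: "Re s + real k \<ge> 1 + d x"
      using abs_Re_le_cmod[of "s - x"] sx by (simp add: d_def field_simps)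
    have ns: "norm (s + of_nat j) \<le> norm x + d x + real j" for j
      using norm_triangle_ineq[of "s - x" "x + of_nat j"] norm_triangle_ineq[of x "of_nat j"] sx
      by simp
    have "norm (powr_diff k s (real (Suc n))) \<le>
        (\<Prod>j<k. norm (s + of_nat j)) * real (Suc n) powr (- (Re s + real k))"
      using re d by (intro norm_powr_diff_le) auto
    also have "\<dots> \<le> (\<Prod>j<k. norm x + d x + real j) * real (Suc n) powr (- (1 + d x))"
      using re d ns by (intro mult_mono prod_mono powr_mono prod_nonneg) auto
    finally show ?thesis
      unfolding norm_mult M_def using B B0 by (intro mult_mono) auto
  qed
  have sM: "summable (M x)" if "Re x > 1 - real k" for x
    unfolding M_def using that
    by (intro summable_mult summable_Suc_powr) (simp add: d_def)
  show ?hol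
  proof (rule holomorphic_uniform_sequence[where f = "\<lambda>N s. \<Sum>n<N. ?f n s"])
    show "open {s. Re s > 1 - real k}" by (simp add: open_halfspace_Re_gt)
    show "(\<lambda>s. \<Sum>n<N. ?f n s) holomorphic_on {s. Re s > 1 - real k}" for N
      by (intro holomorphic_intros holomorphic_powr_diff)
    fix x assume "x \<in> {s. Re s > 1 - real k}"
    then have x: "Re x > 1 - real k" by simp
    have "cball x (d x) \<subseteq> {s. Re s > 1 - real k}"
    proof
      fix s assume "s \<in> cball x (d x)"
      then have "Re x - Re s \<le> d x"
        using complex_Re_le_cmod[of "x - s"] by (simp add: dist_norm)
      then show "s \<in> {s. Re s > 1 - real k}" using x by (simp add: d_def field_simps)
    qed
    moreover have "uniform_limit (cball x (d x)) (\<lambda>N s. \<Sum>n<N. ?f n s) (dirichlet k w) sequentially"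
      unfolding dirichlet_def by (rule Weierstrass_m_test[OF bd[OF x] sM[OF x]])
    ultimately show "\<exists>d>0. cball x d \<subseteq> {s. Re s > 1 - real k} \<and>
        uniform_limit (cball x d) (\<lambda>N s. \<Sum>n<N. ?f n s) (dirichlet k w) sequentially"
      using x by (intro exI[of _ "d x"]) (auto simp: d_def)
  qed
  show "summable (\<lambda>n. ?f n s)" if "Re s > 1 - real k"
    using that by (intro summable_comparison_test'[OF sM[OF that]] bd) (auto simp: d_def)
qed

lemmas dirichlet_holomorphic = dirichlet_holomorphic_summable(1)
lemmas dirichlet_summable = dirichlet_holomorphic_summable(2)

section \<open>Summation by parts and analytic continuation\<close>

text \<open>In the discrete product rule the factor that is not differenced must be evaluated one
  step later in one of the two terms; this is the shift in the series on the right.\<close>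

lemma dirichlet_forward_diff:
  assumes w: "bounded (range w)" and s: "Re s > 1"
  shows "dirichlet k (forward_diff w) s = - w 0 * powr_diff k s 1 - dirichlet (Suc k) (\<lambda>n. w (Suc n)) s"
proof -
  let ?f = "\<lambda>k n. powr_diff k s (real (Suc n))"
  have w': "bounded (range (\<lambda>n. w (Suc n)))"
    using w by (rule bounded_subset) auto
  \<comment> \<open>The boundary term at infinity vanishes because it is the general term of a
    convergent series.\<close>
  have "(\<lambda>n. w n * ?f k n) \<longlonglongrightarrow> 0"
    by (rule summable_LIMSEQ_zero, rule dirichlet_summable) (use w s in auto)
  then have "(\<lambda>n. w (Suc n) * ?f k (Suc n) - w n * ?f k n) sums (0 - w 0 * ?f k 0)"
    by (rule telescope_sums)
  moreover have "(\<lambda>n. w (Suc n) * ?f (Suc k) n) sums dirichlet (Suc k) (\<lambda>n. w (Suc n)) s"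
    unfolding dirichlet_def
    by (rule summable_sums, rule dirichlet_summable) (use w' s in auto)
  ultimately have "(\<lambda>n. w (Suc n) * ?f k (Suc n) - w n * ?f k n - w (Suc n) * ?f (Suc k) n) sums
      (0 - w 0 * ?f k 0 - dirichlet (Suc k) (\<lambda>n. w (Suc n)) s)"
    by (rule sums_diff)
  also have "(\<lambda>n. w (Suc n) * ?f k (Suc n) - w n * ?f k n - w (Suc n) * ?f (Suc k) n) =
      (\<lambda>n. forward_diff w n * ?f k n)"
    by (auto simp: forward_diff_def algebra_simps)
  finally show ?thesis by (simp add: dirichlet_def sums_iff)
qed

text \<open>Every summation by parts moves one difference from the coefficients to the kernel and
  adds an entire function. The sum \<open>k + j\<close> is unchanged, so the half-plane stays the
  same throughout the induction.\<close>

lemma dirichlet_forward_diff_power_extends: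
  "bounded (range w) \<Longrightarrow> \<exists>F. F holomorphic_on {s. Re s > 1 - real (k + j)} \<and>
     (\<forall>s. Re s > 1 \<longrightarrow> F s = dirichlet k ((forward_diff ^^ j) w) s)"
proof (induction j arbitrary: k w)
  case 0
  then show ?case using dirichlet_holomorphic[of w k] by auto
next
  case (Suc j)
  have "bounded (range (\<lambda>n. w (Suc n)))"
    using Suc.prems by (rule bounded_subset) auto
  from Suc.IH[OF this, of "Suc k"] obtain F
    where F: "F holomorphic_on {s. Re s > 1 - real (Suc k + j)}"
      "\<And>s. Re s > 1 \<Longrightarrow> F s = dirichlet (Suc k) ((forward_diff ^^ j) (\<lambda>n. w (Suc n))) s" by blast
  let ?G = "\<lambda>s. - (forward_diff ^^ j) w 0 * powr_diff k s 1 - F s"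
  have "?G holomorphic_on {s. Re s > 1 - real (k + Suc j)}"
    using F(1) by (intro holomorphic_intros holomorphic_powr_diff) auto
  moreover have "?G s = dirichlet k ((forward_diff ^^ Suc j) w) s" if "Re s > 1" for s
    using dirichlet_forward_diff[OF bounded_forward_diff_power[OF Suc.prems] that, of k j] F(2)[OF that]
    by (simp add: forward_diff_power_Suc_index)
  ultimately show ?case by blast
qed

text \<open>The sequences \<open>w\<close> for different \<open>k\<close> need not be related to
  each other. The case \<open>k = 0\<close> says that \<open>u\<close> itself is bounded.\<close>

definition iterated_difference :: "(nat \<Rightarrow> complex) \<Rightarrow> bool" where
  "iterated_difference u \<longleftrightarrow> (\<forall>k. \<exists>w. bounded (range w) \<and> u = (forward_diff ^^ k) w)"

lemma iterated_difference_dirichlet_extends: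
  assumes "iterated_difference u"
  shows "\<exists>F. F analytic_on UNIV \<and> (\<forall>s. Re s > 1 \<longrightarrow> F s = dirichlet 0 u s)"
proof -
  let ?H = "\<lambda>k. {s. Re s > 1 - real k}"
  have "\<exists>F. F holomorphic_on ?H k \<and> (\<forall>s. Re s > 1 \<longrightarrow> F s = dirichlet 0 u s)" for k
    using assms dirichlet_forward_diff_power_extends[of _ 0 k] unfolding iterated_difference_def by fastforce
  then obtain F where F: "\<And>k. F k holomorphic_on ?H k"
    and Fu: "\<And>k s. Re s > 1 \<Longrightarrow> F k s = dirichlet 0 u s" by metis
  have step: "F k s = F l s" if "s \<in> ?H k" "k \<le> l" for k l s
  \<comment> \<open>Both functions equal the Dirichlet series on \<open>?H 0\<close>, the half-plane
    of absolute convergence, and the identity theorem carries the agreement to the connected set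
    \<open>?H k\<close>.\<close>
  proof (rule analytic_continuation_open[of "?H 0" "?H k" "F k" "F l"])
    show "?H 0 \<noteq> {}" by (auto intro!: exI[of _ 2])
    show "connected (?H k)" by (intro convex_connected convex_halfspace_Re_gt)
    show "F l holomorphic_on ?H k" by (rule holomorphic_on_subset[OF F]) (use that in auto)
  qed (use that F Fu in \<open>auto simp: open_halfspace_Re_gt\<close>)
  have eq: "F k s = F l s" if "s \<in> ?H k" "s \<in> ?H l" for k l s
    using nat_le_linear[of k l]
  proof
    assume "k \<le> l"
    then show ?thesis by (rule step[OF that(1)])
  next
    assume "l \<le> k"
    then show ?thesis by (rule step[OF that(2), symmetric])
  qed
  \<comment> \<open>Some index whose half-plane contains \<open>s\<close>; by \<open>eq\<close> the
    value of \<open>G\<close> does not depend on which one is taken.\<close>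
  define K where "K s = nat \<lceil>2 - Re s\<rceil>" for s
  have K: "s \<in> ?H (K s)" for s by (simp add: K_def) linarith
  define G where "G s = F (K s) s" for s
  have G: "G s = F k s" if "s \<in> ?H k" for k s
    unfolding G_def by (rule eq) (use K that in auto)
  have "G holomorphic_on (\<Union>k. ?H k)"
  proof (rule holomorphic_on_UN_open)
    show "G holomorphic_on ?H k" for k
      using F[of k] by (rule holomorphic_transform) (simp add: G)
  qed (simp add: open_halfspace_Re_gt)
  moreover have "(\<Union>k. ?H k) = UNIV" using K by blast
  ultimately have "G analytic_on UNIV" by (simp add: analytic_on_open)
  moreover have "G s = dirichlet 0 u s" if "Re s > 1" for s
    using G[of s 0] Fu that by simp
  ultimately show ?thesis by blast
qed

subsection \<open>Fourier series of periodic functions\<close>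

definition unit_char :: "real \<Rightarrow> complex" where
  "unit_char x = cis (2 * pi * x)"

lemma unit_char_add: "unit_char (x + y) = unit_char x * unit_char y"
  by (simp add: unit_char_def cis_mult distrib_left)

lemma unit_char_diff: "unit_char (x - y) = unit_char x * unit_char (- y)"
  using unit_char_add[of x "- y"] by simp

lemma unit_char_of_int [simp]: "unit_char (of_int m) = 1"
  by (simp add: unit_char_def cis_multiple_2pi)

lemma unit_char_0 [simp]: "unit_char 0 = 1"
  by (simp add: unit_char_def)

lemma norm_unit_char [simp]: "norm (unit_char x) = 1"
  by (simp add: unit_char_def)

lemma unit_char_mult_minus: "unit_char x * unit_char (- x) = 1"
  by (simp add: unit_char_add[symmetric])

lemma unit_char_power: "unit_char x ^ n = unit_char (real n * x)"
  unfolding unit_char_def Complex.DeMoivre by (simp only: mult_ac)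

lemma unit_char_eq_1_iff: "unit_char x = 1 \<longleftrightarrow> x \<in> \<int>"
proof
  assume "unit_char x = 1"
  then have "cos (2 * pi * x) = 1" by (simp add: unit_char_def complex_eq_iff)
  then obtain n :: int where "2 * pi * x = of_int n * 2 * pi" using cos_one_2pi_int by auto
  then have "x = of_int n" by simp
  then show "x \<in> \<int>" by simp
qed (auto elim: Ints_cases)

lemma unit_char_has_vector_derivative:
  "((\<lambda>t. unit_char (c * t)) has_vector_derivative (2 * pi * \<i> * c * unit_char (c * t))) (at t within A)"
proof -
  have "((\<lambda>t. cis (2 * pi * (c * t))) has_vector_derivative (2 * pi * c) *\<^sub>R (\<i> * cis (2 * pi * (c * t))))
      (at t within A)"
    unfolding has_vector_derivative_def by (rule has_derivative_cis[THEN has_derivative_eq_rhs])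
      (auto intro!: derivative_eq_intros simp: mult_ac)
  then show ?thesis by (simp add: unit_char_def scaleR_conv_of_real mult_ac)
qed

lemma continuous_on_unit_char [continuous_intros]:
  "continuous_on A f \<Longrightarrow> continuous_on A (\<lambda>t. unit_char (f t))"
  unfolding unit_char_def by (intro continuous_intros)

definition fourier_coeff :: "(real \<Rightarrow> complex) \<Rightarrow> int \<Rightarrow> complex" where
  "fourier_coeff f m = integral {0..1} (\<lambda>t. f t * unit_char (- of_int m * t))"

lemma fourier_coeff_integrable:
  assumes "continuous_on {0..1} f"
  shows "(\<lambda>t. f t * unit_char (c * t)) integrable_on {0..1}"
  by (intro integrable_continuous_real continuous_intros assms)

lemma norm_fourier_coeff_le:
  assumes "continuous_on {0..1} f" "\<And>t. t \<in> {0..1} \<Longrightarrow> norm (f t) \<le> B"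
  shows "norm (fourier_coeff f m) \<le> B"
proof -
  have "norm (fourier_coeff f m) \<le> B * (1 - 0)" unfolding fourier_coeff_def
    by (rule integral_bound) (use assms in \<open>auto intro!: continuous_intros simp: norm_mult\<close>)
  then show ?thesis by simp
qed

lemma fourier_coeff_diff:
  assumes "continuous_on {0..1} f" "continuous_on {0..1} h"
  shows "fourier_coeff (\<lambda>t. f t - h t) m = fourier_coeff f m - fourier_coeff h m"
  unfolding fourier_coeff_def left_diff_distrib by (intro integral_diff fourier_coeff_integrable assms)

lemma fourier_coeff_const: "fourier_coeff (\<lambda>t. c) m = (if m = 0 then c else 0)"
proof (cases "m = 0")
  case True
  then show ?thesis by (simp add: fourier_coeff_def)
next
  case False
  let ?E = "\<lambda>t. c * (unit_char (- of_int m * t) / (- 2 * pi * \<i> * m))"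
  have "(?E has_vector_derivative c * unit_char (- of_int m * t)) (at t within {0..1})" for t
    using False has_vector_derivative_mult_right[OF has_vector_derivative_divide[OF
        unit_char_has_vector_derivative[of "- of_int m" t "{0..1}"], of "- 2 * pi * \<i> * m"], of c]
    by simp
  then have "((\<lambda>t. c * unit_char (- of_int m * t)) has_integral (?E 1 - ?E 0)) {0..1}"
    by (intro fundamental_theorem_of_calculus) auto
  moreover have "unit_char (- of_int m * 1) = 1" using unit_char_of_int[of "- m"] by simp
  ultimately have "((\<lambda>t. c * unit_char (- of_int m * t)) has_integral 0) {0..1}" by simp
  then show ?thesis using False unfolding fourier_coeff_def by (simp only: integral_unique if_False)
qed

text \<open>Integration by parts. The boundary term is kept because the formula is also applied to
  polynomials, which need not be periodic.\<close>

lemma fourier_coeff_derivative: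
  assumes f: "\<And>t. (f has_vector_derivative f' t) (at t)" and f': "continuous_on {0..1} f'"
  shows "fourier_coeff f' m = f 1 - f 0 + 2 * pi * \<i> * m * fourier_coeff f m"
proof -
  have cf: "continuous_on {0..1} f"
    by (meson f continuous_at_imp_continuous_on has_vector_derivative_continuous)
  let ?E = "\<lambda>t. unit_char (- of_int m * t)"
  have "((\<lambda>t. f t * ?E t) has_vector_derivative
      (f t * (2 * pi * \<i> * (- of_int m) * ?E t) + f' t * ?E t)) (at t within {0..1})" for t
    using has_vector_derivative_mult[OF has_vector_derivative_at_within[OF f[of t]]
        unit_char_has_vector_derivative[of "- of_int m" t "{0..1}"]]
    by simp
  then have "((\<lambda>t. f t * (2 * pi * \<i> * (- of_int m) * ?E t) + f' t * ?E t) has_integral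
      f 1 * ?E 1 - f 0 * ?E 0) {0..1}"
    by (intro fundamental_theorem_of_calculus) auto
  moreover have "((\<lambda>t. (2 * pi * \<i> * (- of_int m)) * (f t * ?E t) + f' t * ?E t) has_integral
      (2 * pi * \<i> * (- of_int m)) * fourier_coeff f m + fourier_coeff f' m) {0..1}"
    unfolding fourier_coeff_def
    by (intro has_integral_add has_integral_mult_right integrable_integral fourier_coeff_integrable cf f')
  ultimately have "f 1 * ?E 1 - f 0 * ?E 0 = (2 * pi * \<i> * (- of_int m)) * fourier_coeff f m + fourier_coeff f' m"
    by (intro has_integral_unique[of _ _ "{0..1}"]) (auto simp: mult_ac)
  moreover have "?E 1 = 1" using unit_char_of_int[of "- m"] by simp
  ultimately show ?thesis by (simp add: algebra_simps)
qed

section \<open>Riemann--Lebesgue lemma and pointwise convergence\<close>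

text \<open>A polynomial approximates \<open>f\<close> uniformly within \<open>e / 2\<close>, and
  one integration by parts shows that the coefficients of the polynomial are of order
  \<open>1 / m\<close>.\<close>

lemma riemann_lebesgue:
  assumes f: "continuous_on {0..1} f" and e: "e > 0"
  shows "\<exists>N>0. \<forall>m. real_of_int \<bar>m\<bar> \<ge> N \<longrightarrow> norm (fourier_coeff f m) \<le> e"
proof -
  obtain p where p: "polynomial_function p" and fp: "\<And>t. t \<in> {0..1} \<Longrightarrow> norm (f t - p t) < e / 2"
    using Stone_Weierstrass_polynomial_function[OF compact_Icc f, of "e / 2"] e by auto
  obtain p' where p': "polynomial_function p'" "\<And>t. (p has_vector_derivative p' t) (at t)"
    using has_vector_derivative_polynomial_function[OF p] by blast
  have cp: "continuous_on {0..1} p" "continuous_on {0..1} p'"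
    using p p' by (auto intro: continuous_on_polymonial_function)
  have "bounded (p' ` {0..1})" by (intro compact_imp_bounded compact_continuous_image cp) simp
  then obtain B where B: "\<And>t. t \<in> {0..1} \<Longrightarrow> norm (p' t) \<le> B"
    unfolding bounded_iff by blast
  define A where "A = B + norm (p 1 - p 0)"
  have A0: "A \<ge> 0" using order_trans[OF norm_ge_zero B[of 0]] by (simp add: A_def)
  have A: "norm (fourier_coeff p m) * real_of_int \<bar>m\<bar> \<le> A" for m
  proof -
    have "2 * pi * \<i> * m * fourier_coeff p m = fourier_coeff p' m - (p 1 - p 0)"
      using fourier_coeff_derivative[OF p'(2) cp(2), of m] by simp
    then have "norm (2 * pi * \<i> * m * fourier_coeff p m) \<le> norm (fourier_coeff p' m) + norm (p 1 - p 0)"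
      by (metis norm_triangle_ineq4)
    also have "\<dots> \<le> A" unfolding A_def by (intro add_right_mono norm_fourier_coeff_le cp B)
    finally have "2 * pi * (norm (fourier_coeff p m) * real_of_int \<bar>m\<bar>) \<le> A"
      by (simp add: norm_mult mult_ac)
    moreover have "1 * (norm (fourier_coeff p m) * real_of_int \<bar>m\<bar>) \<le> 2 * pi * (norm (fourier_coeff p m) * real_of_int \<bar>m\<bar>)"
      using pi_ge_two by (intro mult_right_mono) auto
    ultimately show ?thesis by linarith
  qed
  \<comment> \<open>Chosen so that \<open>A\<close> is at most \<open>e / 2 * N\<close>; the summand
    1 keeps \<open>N\<close> positive even if \<open>A\<close> is 0.\<close>
  define N where "N = 2 * A / e + 1"
  have N0: "N > 0" using A0 e by (simp add: N_def add_nonneg_pos)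
  have "norm (fourier_coeff f m) \<le> e" if m: "real_of_int \<bar>m\<bar> \<ge> N" for m
  proof -
    have "norm (fourier_coeff f m) \<le> norm (fourier_coeff (\<lambda>t. f t - p t) m) + norm (fourier_coeff p m)"
      using norm_triangle_ineq[of "fourier_coeff f m - fourier_coeff p m" "fourier_coeff p m"] by (simp add: fourier_coeff_diff f cp)
    moreover have "norm (fourier_coeff (\<lambda>t. f t - p t) m) \<le> e / 2"
      by (rule norm_fourier_coeff_le) (use fp f cp in \<open>auto intro!: continuous_intros less_imp_le\<close>)
    moreover have "norm (fourier_coeff p m) \<le> e / 2"
    proof -
      have "norm (fourier_coeff p m) * N \<le> norm (fourier_coeff p m) * real_of_int \<bar>m\<bar>"
        using m by (intro mult_left_mono) auto
      also have "\<dots> \<le> A" by (rule A)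
      also have "\<dots> \<le> e / 2 * N" using e by (simp add: N_def field_simps)
      finally show ?thesis using N0 by (simp add: mult_le_cancel_right)
    qed
    ultimately show ?thesis by simp
  qed
  then show ?thesis using N0 by blast
qed

lemma periodic_of_int:
  assumes "\<And>x::real. f (x + 1) = f x"
  shows "f (x + of_int m) = f x"
proof (induction m rule: int_induct[of _ 0])
  case base then show ?case by simp
next
  case (step1 i)
  then show ?case using assms[of "x + of_int i"] by (simp add: add.assoc)
next
  case (step2 i)
  then show ?case using assms[of "x + of_int i - 1"] by (simp add: algebra_simps)
qed

lemma difference_quotient_tendsto:
  fixes f :: "real \<Rightarrow> complex"
  assumes "(f has_vector_derivative D) (at x)"
  shows "((\<lambda>t. (f t - f x) / of_real (t - x)) \<longlongrightarrow> D) (at x)"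
proof -
  have "((\<lambda>t. norm (f t - f x - (t - x) *\<^sub>R D) / norm (t - x)) \<longlongrightarrow> 0) (at x)"
    using assms by (simp add: has_vector_derivative_def has_derivative_iff_norm)
  moreover have "\<forall>\<^sub>F t in at x. norm (f t - f x - (t - x) *\<^sub>R D) / norm (t - x) =
      norm ((f t - f x) / of_real (t - x) - D)"
    unfolding eventually_at
  proof (intro exI[of _ 1] conjI ballI impI)
    fix t assume "t \<noteq> x \<and> dist t x < 1"
    then have "(f t - f x) / of_real (t - x) - D = (f t - f x - (t - x) *\<^sub>R D) / of_real (t - x)"
      by (simp add: diff_divide_distrib scaleR_conv_of_real)
    then show "norm (f t - f x - (t - x) *\<^sub>R D) / norm (t - x) =
        norm ((f t - f x) / of_real (t - x) - D)"
      by (metis norm_divide norm_of_real real_norm_def)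
  qed simp
  ultimately have "((\<lambda>t. norm ((f t - f x) / of_real (t - x) - D)) \<longlongrightarrow> 0) (at x)"
    by (rule Lim_transform_eventually)
  then show ?thesis using tendsto_norm_zero_iff LIM_zero_iff by blast
qed

text \<open>
  Since \<open>f t - f x\<close> is a continuous multiple of \<open>exp (2 \<pi> i (t - x)) - 1\<close>, its Fourier coefficients
  are differences of consecutive coefficients of the quotient, so the partial sums of the Fourier
  series telescope and the Riemann--Lebesgue lemma gives pointwise convergence.
\<close>
lemma unit_char_quotient_factor:
  assumes f: "\<And>t. (f has_vector_derivative f' t) (at t)" and per: "\<And>t. f (t + 1) = f t"
  obtains q where "continuous_on UNIV q" "\<And>t. f t - f x = q t * (unit_char (t - x) - 1)"
proof
  \<comment> \<open>At the zeros of the denominator the value is the quotient of the derivatives at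
    \<open>x\<close>, as in l'Hopital's rule; by periodicity the same value serves at every integer
    translate of \<open>x\<close>.\<close>
  define q where "q t = (if t - x \<in> \<int> then f' x / (2 * pi * \<i>)
      else (f t - f x) / (unit_char (t - x) - 1))" for t
  show "f t - f x = q t * (unit_char (t - x) - 1)" for t
  proof (cases "t - x \<in> \<int>")
    case True
    then obtain m where "t = x + of_int m" by (auto elim!: Ints_cases simp: algebra_simps)
    then show ?thesis using periodic_of_int[of f, OF per] True by simp
  next
    case False
    then show ?thesis by (simp add: q_def unit_char_eq_1_iff)
  qed
  have q_per: "q (t + of_int m) = q t" for t m
  proof -
    have "t + of_int m - x \<in> \<int> \<longleftrightarrow> t - x \<in> \<int>"
    proof
      show "t - x \<in> \<int>" if "t + of_int m - x \<in> \<int>"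
        using Ints_diff[OF that Ints_of_int[of m]] by simp
      show "t + of_int m - x \<in> \<int>" if "t - x \<in> \<int>"
        using Ints_add[OF that Ints_of_int[of m]] by (simp add: algebra_simps)
    qed
    moreover have "unit_char (t + of_int m - x) = unit_char (t - x)"
      using unit_char_add[of "t - x" "of_int m"] by (simp add: algebra_simps)
    ultimately show ?thesis by (simp add: q_def periodic_of_int[of f, OF per])
  qed
  have qx: "isCont q x"
  proof -
    have "((\<lambda>t. unit_char (t - x)) has_vector_derivative 2 * pi * \<i>) (at x)"
      using has_vector_derivative_mult_left[OF unit_char_has_vector_derivative[of 1 x UNIV], of "unit_char (- x)"]
      by (simp add: unit_char_diff[symmetric] mult.assoc unit_char_mult_minus)
    from tendsto_divide[OF difference_quotient_tendsto[OF f[of x]] difference_quotient_tendsto[OF this]]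
    have "((\<lambda>t. ((f t - f x) / of_real (t - x)) / ((unit_char (t - x) - 1) / of_real (t - x)))
        \<longlongrightarrow> f' x / (2 * pi * \<i>)) (at x)"
      by simp
    moreover have "\<forall>\<^sub>F t in at x.
        ((f t - f x) / of_real (t - x)) / ((unit_char (t - x) - 1) / of_real (t - x)) = q t"
      unfolding eventually_at
    proof (intro exI[of _ 1] conjI ballI impI)
      fix t assume t: "t \<noteq> x \<and> dist t x < 1"
      have "t - x \<notin> \<int>"
      proof
        assume "t - x \<in> \<int>"
        then obtain z where z: "t - x = of_int z" by (elim Ints_cases)
        then have "\<bar>z\<bar> < 1" using t unfolding dist_real_def by linarith
        then show False using z t by simp
      qed
      then show "((f t - f x) / of_real (t - x)) / ((unit_char (t - x) - 1) / of_real (t - x)) = q t"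
        using t by (simp add: q_def)
    qed simp
    ultimately have "(q \<longlongrightarrow> f' x / (2 * pi * \<i>)) (at x)"
      by (rule Lim_transform_eventually)
    then show ?thesis by (simp add: isCont_def q_def)
  qed
  have "isCont q t" for t
  proof (cases "t - x \<in> \<int>")
    case True
    then obtain m where m: "t = x + of_int m" by (auto elim!: Ints_cases simp: algebra_simps)
    \<comment> \<open>Continuity at \<open>x\<close> is transported to its integer translates by the
      periodicity of \<open>q\<close>.\<close>
    have "isCont (\<lambda>s. q (s + of_int (- m))) t"
      by (rule isCont_o2[where g = q]) (simp_all add: m qx)
    then show ?thesis by (simp only: q_per)
  next
    case False
    have "isCont f t" using f by (rule has_vector_derivative_continuous)
    moreover have "isCont (\<lambda>t. unit_char (t - x)) t"
      by (intro continuous_on_interior[of UNIV] continuous_intros) auto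
    ultimately have "isCont (\<lambda>t. (f t - f x) / (unit_char (t - x) - 1)) t"
      using False by (intro continuous_intros) (auto simp: unit_char_eq_1_iff)
    moreover have "\<forall>\<^sub>F s in nhds t. q s = (f s - f x) / (unit_char (s - x) - 1)"
    proof -
      have "\<forall>\<^sub>F s in nhds t. s - x \<in> - \<int>"
      proof (rule topological_tendstoD)
        show "((\<lambda>s. s - x) \<longlongrightarrow> t - x) (nhds t)" 
          by (rule tendsto_diff[OF filterlim_ident tendsto_const])
        show "open (- \<int> :: real set)" by (rule open_Compl[OF closed_Ints])
        show "t - x \<in> - \<int>" using False by simp
      qed
      then show ?thesis by eventually_elim (simp add: q_def)
    qed
    ultimately show ?thesis by (simp only: isCont_cong)
  qed
  then show "continuous_on UNIV q" by (simp add: continuous_at_imp_continuous_on)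
qed

text \<open>Opposite frequencies are paired, so the partial sums are the symmetric ones, and the
  term of frequency 0 stands on the right.\<close>

lemma fourier_sums:
  assumes f: "\<And>t. (f has_vector_derivative f' t) (at t)" and per: "\<And>t. f (t + 1) = f t"
  shows "(\<lambda>n. fourier_coeff f (int (Suc n)) * unit_char (real (Suc n) * x) +
              fourier_coeff f (- int (Suc n)) * unit_char (- real (Suc n) * x)) sums (f x - fourier_coeff f 0)"
proof -
  obtain q where q: "continuous_on UNIV q" and fq: "\<And>t. f t - f x = q t * (unit_char (t - x) - 1)"
    using unit_char_quotient_factor[OF f per] by metis
  have cf: "continuous_on {0..1} f"
    by (meson f continuous_at_imp_continuous_on has_vector_derivative_continuous)
  have cq: "continuous_on {0..1} q" using q continuous_on_subset by blast
  \<comment> \<open>With these quantities the term of frequency \<open>m\<close> becomes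
    \<open>a (m - 1) - a m\<close>, up to the constant \<open>f x\<close> at
    \<open>m = 0\<close>.\<close>
  define a where "a m = fourier_coeff q m * unit_char (of_int m * x)" for m
  have a: "fourier_coeff f m * unit_char (of_int m * x) = (if m = 0 then f x else 0) + a (m - 1) - a m" for m
  proof -
    have "fourier_coeff f m - fourier_coeff (\<lambda>t. f x) m = fourier_coeff (\<lambda>t. f t - f x) m"
      by (simp add: fourier_coeff_diff cf)
    also have "\<dots> = integral {0..1} (\<lambda>t. (q t * unit_char (- of_int (m - 1) * t)) * unit_char (- x)
        - q t * unit_char (- of_int m * t))"
      unfolding fourier_coeff_def fq
    proof (intro arg_cong[of _ _ "integral _"] ext)
      fix t
      have "unit_char (- of_int (m - 1) * t) = unit_char t * unit_char (- of_int m * t)"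
        by (simp add: unit_char_add[symmetric] algebra_simps)
      then show "q t * (unit_char (t - x) - 1) * unit_char (- of_int m * t) =
          q t * unit_char (- of_int (m - 1) * t) * unit_char (- x) - q t * unit_char (- of_int m * t)"
        by (simp add: unit_char_diff algebra_simps)
    qed
    also have "\<dots> = fourier_coeff q (m - 1) * unit_char (- x) - fourier_coeff q m"
      unfolding fourier_coeff_def using fourier_coeff_integrable[OF cq, of "- of_int m"] fourier_coeff_integrable[OF cq, of "- of_int (m - 1)"]
      by (simp add: integral_diff integrable_on_mult_left)
    finally have "fourier_coeff f m = fourier_coeff (\<lambda>t. f x) m + fourier_coeff q (m - 1) * unit_char (- x) - fourier_coeff q m"
      by (simp add: algebra_simps)
    moreover have "unit_char (- x) * unit_char (of_int m * x) = unit_char (of_int (m - 1) * x)"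
      by (simp add: unit_char_add[symmetric] algebra_simps)
    ultimately have "fourier_coeff f m * unit_char (of_int m * x) = fourier_coeff (\<lambda>t. f x) m * unit_char (of_int m * x) +
        fourier_coeff q (m - 1) * unit_char (of_int (m - 1) * x) - fourier_coeff q m * unit_char (of_int m * x)"
      by (metis (no_types) distrib_right left_diff_distrib mult.assoc)
    then show ?thesis by (simp add: a_def fourier_coeff_const)
  qed
  \<comment> \<open>The two signs of \<open>c\<close> cover the two ends of a symmetric partial
    sum.\<close>
  have a0: "(\<lambda>n. a (c * int n + d)) \<longlonglongrightarrow> 0" if "\<bar>c\<bar> = 1" for c d
  proof (rule LIMSEQ_I)
    fix e :: real assume e: "e > 0"
    obtain N where N: "\<And>m. real_of_int \<bar>m\<bar> \<ge> N \<Longrightarrow> norm (fourier_coeff q m) \<le> e / 2"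
      using riemann_lebesgue[OF cq, of "e / 2"] e by auto
    have "norm (a (c * int n + d) - 0) < e" if "n \<ge> nat \<lceil>N\<rceil> + nat \<bar>d\<bar>" for n
    proof -
      have "\<bar>c * int n + d\<bar> \<ge> \<lceil>N\<rceil>" using that \<open>\<bar>c\<bar> = 1\<close> by (auto simp: abs_if split: if_splits)
      then have "real_of_int \<bar>c * int n + d\<bar> \<ge> N" by linarith
      from N[OF this] show ?thesis using e by (simp add: a_def norm_mult)
    qed
    then show "\<exists>n0. \<forall>n\<ge>n0. norm (a (c * int n + d) - 0) < e" by blast
  qed
  have eq: "fourier_coeff f (int (Suc n)) * unit_char (real (Suc n) * x) +
        fourier_coeff f (- int (Suc n)) * unit_char (- real (Suc n) * x) =
      (a (- int (Suc n) - 1) - a (int (Suc n))) - (a (- int n - 1) - a (int n))" for n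
  proof -
    have "fourier_coeff f (int (Suc n)) * unit_char (real (Suc n) * x) = a (int n) - a (int (Suc n))"
      using a[of "int (Suc n)"] by simp
    moreover have e: "a (- int (Suc n)) = a (- int n - 1)" by (rule arg_cong[of _ _ a]) simp
    have "real_of_int (- int (Suc n)) = - real (Suc n)" by simp
    from a[of "- int (Suc n)", unfolded this e]
    have "fourier_coeff f (- int (Suc n)) * unit_char (- real (Suc n) * x) =
        a (- int (Suc n) - 1) - a (- int n - 1)"
      by (simp del: of_nat_Suc)
    ultimately show ?thesis by simp
  qed
  have "(\<lambda>n. a (- int n - 1) - a (int n)) \<longlonglongrightarrow> 0 - 0"
    using a0[of "-1" "-1"] a0[of 1 0] by (intro tendsto_diff) auto
  then have "(\<lambda>n. (a (- int (Suc n) - 1) - a (int (Suc n))) - (a (- int n - 1) - a (int n))) sums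
      (0 - (a (- int 0 - 1) - a (int 0)))"
    by (intro telescope_sums) simp
  \<comment> \<open>The value left over at the start of the telescoping sum is identified by the
    relation for frequency 0, where the constant \<open>f x\<close> enters.\<close>
  moreover have "0 - (a (- int 0 - 1) - a (int 0)) = f x - fourier_coeff f 0"
    using a[of 0] by (simp add: algebra_simps)
  ultimately show ?thesis unfolding eq by simp
qed

subsection \<open>Small divisors\<close>

text \<open>A forward difference multiplies the exponential sequence of base \<open>l m\<close> by
  \<open>l m - 1\<close>. This factor has norm at most 2, so absolute convergence survives every
  difference.\<close>

lemma forward_diff_power_exponential_series:
  assumes l: "\<And>m. norm (l m) = 1" and d: "summable (\<lambda>m. norm (d m))"
  shows "(forward_diff ^^ k) (\<lambda>n. \<Sum>m. d m * l m ^ n) = (\<lambda>n. \<Sum>m. d m * (l m - 1) ^ k * l m ^ n)"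
proof (induction k)
  case (Suc k)
  have s: "summable (\<lambda>m. d m * (l m - 1) ^ k * l m ^ n)" for n
  proof (rule summable_comparison_test')
    show "summable (\<lambda>m. norm (d m) * 2 ^ k)" by (intro summable_mult2 d)
    have "norm (l m - 1) \<le> 2" for m
      using norm_triangle_ineq4[of "l m" 1] l[of m] by simp
    then show "norm (d m * (l m - 1) ^ k * l m ^ n) \<le> norm (d m) * 2 ^ k" for m
      by (simp add: norm_mult norm_power l mult_left_mono power_mono)
  qed
  show ?case
    unfolding funpow.simps o_apply Suc.IH
    by (rule ext) (simp only: forward_diff_def suminf_diff[OF s s], simp add: algebra_simps)
qed simp

text \<open>Division by powers of \<open>l m - 1\<close> inverts the differences term by term. The
  quotients are absolutely summable, which bounds the resulting sequence uniformly in
  \<open>n\<close>.\<close>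

lemma iterated_difference_series:
  assumes l: "\<And>m. norm (l m) = 1" "\<And>m. l m \<noteq> 1"
    and b: "\<And>k. summable (\<lambda>m. norm (b m) / norm (l m - 1) ^ k)"
  shows "iterated_difference (\<lambda>n. \<Sum>m. b m * l m ^ n)"
  unfolding iterated_difference_def
proof
  fix k
  define d where "d m = b m / (l m - 1) ^ k" for m
  have d: "summable (\<lambda>m. norm (d m))" using b[of k] by (simp add: d_def norm_divide norm_power)
  have "norm (\<Sum>m. d m * l m ^ n) \<le> (\<Sum>m. norm (d m))" for n
    using summable_norm[of "\<lambda>m. d m * l m ^ n"] d by (simp add: norm_mult norm_power l)
  then have "bounded (range (\<lambda>n. \<Sum>m. d m * l m ^ n))" unfolding bounded_iff by blast
  moreover have "(\<lambda>n. \<Sum>m. b m * l m ^ n) = (forward_diff ^^ k) (\<lambda>n. \<Sum>m. d m * l m ^ n)"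
    unfolding forward_diff_power_exponential_series[OF l(1) d] using l(2) by (simp add: d_def)
  ultimately show "\<exists>w. bounded (range w) \<and> (\<lambda>n. \<Sum>m. b m * l m ^ n) = (forward_diff ^^ k) w" by blast
qed

lemma forward_diff_power_add: "(forward_diff ^^ k) (\<lambda>n. v n + w n) = (\<lambda>n. (forward_diff ^^ k) v n + (forward_diff ^^ k) w n)"
  by (induction k) (auto simp: forward_diff_def)

lemma iterated_difference_add:
  assumes "iterated_difference u" "iterated_difference v"
  shows "iterated_difference (\<lambda>n. u n + v n)"
  unfolding iterated_difference_def
proof
  fix k
  obtain w z where "bounded (range w)" "u = (forward_diff ^^ k) w" "bounded (range z)" "v = (forward_diff ^^ k) z"
    using assms unfolding iterated_difference_def by metis
  then show "\<exists>w. bounded (range w) \<and> (\<lambda>n. u n + v n) = (forward_diff ^^ k) w"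
    by (intro exI[of _ "\<lambda>n. w n + z n"]) (simp add: forward_diff_power_add bounded_plus_comp)
qed

section \<open>Real analytic functions and the decay of their Fourier coefficients\<close>

text \<open>Termwise differentiation of the local power series. Analyticity of the derivative is
  part of the conclusion so that the lemma can be iterated.\<close>

lemma real_analytic_has_derivative:
  assumes "real_analytic g"
  obtains g' where "\<And>x. (g has_vector_derivative g' x) (at x)" "real_analytic g'"
proof
  let ?g' = "\<lambda>x. vector_derivative g (at x)"
  have local: "\<exists>a \<epsilon>. \<epsilon> > 0 \<and> (\<forall>x. \<bar>x - x0\<bar> < \<epsilon> \<longrightarrow>
      (\<lambda>k. a k * of_real (x - x0) ^ k) sums ?g' x \<and> (g has_vector_derivative ?g' x) (at x))" for x0
  proof -
    obtain a \<epsilon> where e: "\<epsilon> > 0"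
      and a: "\<And>x. \<bar>x - x0\<bar> < \<epsilon> \<Longrightarrow> (\<lambda>k. a k * of_real (x - x0) ^ k) sums g x"
      using assms unfolding real_analytic_def by metis
    \<comment> \<open>The hypothesis gives convergence only at real points. A real point of modulus
      between \<open>norm z\<close> and \<epsilon> yields it at the complex point
      \<open>z\<close>.\<close>
    have sm: "summable (\<lambda>k. a k * z ^ k)" if "norm z < \<epsilon>" for z
    proof (rule powser_inside)
      have r: "0 \<le> (norm z + \<epsilon>) / 2" "(norm z + \<epsilon>) / 2 < \<epsilon>"
        using that add_nonneg_nonneg[OF norm_ge_zero[of z] less_imp_le[OF e]] by (simp_all add: field_simps)
      then have "\<bar>(x0 + (norm z + \<epsilon>) / 2) - x0\<bar> < \<epsilon>" by simp
      from a[OF this] show "summable (\<lambda>k. a k * of_real ((norm z + \<epsilon>) / 2) ^ k)"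
        by (simp add: sums_iff)
      show "norm z < norm (of_real ((norm z + \<epsilon>) / 2) :: complex)"
        unfolding norm_of_real abs_of_nonneg[OF r(1)] using that by simp
    qed
    have "(\<lambda>k. diffs a k * of_real (x - x0) ^ k) sums ?g' x \<and> (g has_vector_derivative ?g' x) (at x)"
      if x: "\<bar>x - x0\<bar> < \<epsilon>" for x
    proof -
      let ?z = "complex_of_real (x - x0)"
      let ?D = "\<Sum>k. diffs a k * ?z ^ k"
      have z: "norm ?z < \<epsilon>" unfolding norm_of_real using x .
      have "((\<lambda>z. \<Sum>k. a k * z ^ k) has_field_derivative ?D) (at ?z)"
        by (rule termdiffs_strong'[OF sm z])
      then have "((\<lambda>z. \<Sum>k. a k * (z - of_real x0) ^ k) has_field_derivative ?D * 1) (at (of_real x))"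
        by (intro DERIV_chain2[of "\<lambda>z. \<Sum>k. a k * z ^ k"]) (auto intro!: derivative_eq_intros)
      then have "((\<lambda>y. \<Sum>k. a k * (of_real y - of_real x0) ^ k) has_vector_derivative ?D) (at x)"
        using has_vector_derivative_real_field by fastforce
      then have D: "(g has_vector_derivative ?D) (at x)"
      proof (rule has_vector_derivative_transform_within_open[where S = "{x0 - \<epsilon><..<x0 + \<epsilon>}"])
        fix y assume "y \<in> {x0 - \<epsilon><..<x0 + \<epsilon>}"
        then show "(\<Sum>k. a k * (of_real y - of_real x0) ^ k) = g y"
          using a[of y] by (simp add: sums_iff abs_less_iff)
      qed (use x in \<open>auto simp: abs_less_iff\<close>)
      moreover have "(\<lambda>k. diffs a k * ?z ^ k) sums ?D"
        by (intro summable_sums termdiff_converges[OF z sm])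
      ultimately show ?thesis using vector_derivative_at[OF D] by simp
    qed
    then show ?thesis using e by blast
  qed
  show "(g has_vector_derivative ?g' x) (at x)" for x using local[of x] by force
  show "real_analytic ?g'" unfolding real_analytic_def using local by blast
qed

lemma periodic_derivative:
  assumes g: "\<And>x. (g has_vector_derivative g' x) (at x)" and per: "\<And>x::real. g (x + 1) = g x"
  shows "g' (x + 1) = g' x"
proof -
  have "((\<lambda>x. x + 1) has_vector_derivative 1) (at x)" by (auto intro!: derivative_eq_intros)
  from vector_diff_chain_at[OF this g] have "(g has_vector_derivative g' (x + 1)) (at x)"
    by (simp add: o_def per)
  then show ?thesis using g vector_derivative_unique_at by blast
qed

text \<open>Repeated integration by parts: periodicity cancels the boundary terms, each round gains
  a factor \<open>2 * pi * m\<close>, and the derivative again satisfies the hypotheses.\<close>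

lemma fourier_coeff_rapid_decay:
  assumes "real_analytic g" "\<And>x. g (x + 1) = g x"
  shows "\<exists>A. \<forall>m. norm (fourier_coeff g m) * real_of_int \<bar>m\<bar> ^ N \<le> A"
  using assms
proof (induction N arbitrary: g)
  case 0
  obtain g' where g': "\<And>x. (g has_vector_derivative g' x) (at x)"
    using real_analytic_has_derivative[OF 0(1)] by metis
  have c: "continuous_on {0..1} g"
    by (meson g' continuous_at_imp_continuous_on has_vector_derivative_continuous)
  then have "bounded (g ` {0..1})" by (intro compact_imp_bounded compact_continuous_image) simp_all
  then obtain B where "\<And>t. t \<in> {0..1} \<Longrightarrow> norm (g t) \<le> B" unfolding bounded_iff by blast
  with norm_fourier_coeff_le[OF c] show ?case by auto
next
  case (Suc N)
  obtain g' where g': "\<And>x. (g has_vector_derivative g' x) (at x)" and a: "real_analytic g'"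
    using real_analytic_has_derivative[OF Suc.prems(1)] by metis
  obtain g'' where g'': "\<And>x. (g' has_vector_derivative g'' x) (at x)"
    using real_analytic_has_derivative[OF a] by metis
  have c: "continuous_on {0..1} g'"
    by (meson g'' continuous_at_imp_continuous_on has_vector_derivative_continuous)
  obtain A where A: "\<And>m. norm (fourier_coeff g' m) * real_of_int \<bar>m\<bar> ^ N \<le> A"
    using Suc.IH[OF a periodic_derivative[OF g' Suc.prems(2)]] by metis
  have "norm (fourier_coeff g m) * real_of_int \<bar>m\<bar> ^ Suc N \<le> A" for m
  proof -
    have "fourier_coeff g' m = 2 * pi * \<i> * m * fourier_coeff g m"
      using fourier_coeff_derivative[OF g' c, of m] Suc.prems(2)[of 0] by simp
    then have "norm (fourier_coeff g' m) = 2 * pi * (real_of_int \<bar>m\<bar> * norm (fourier_coeff g m))"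
      by (simp add: norm_mult mult_ac)
    also have "\<dots> \<ge> 1 * (real_of_int \<bar>m\<bar> * norm (fourier_coeff g m))"
      using pi_ge_two by (intro mult_right_mono) auto
    finally have "real_of_int \<bar>m\<bar> * norm (fourier_coeff g m) * real_of_int \<bar>m\<bar> ^ N \<le> norm (fourier_coeff g' m) * real_of_int \<bar>m\<bar> ^ N"
      by (intro mult_right_mono) auto
    also have "\<dots> \<le> A" by (rule A)
    finally show ?thesis by (simp add: mult_ac)
  qed
  then show ?case by blast
qed

section \<open>Lower bounds for the divisors\<close>

lemma norm_unit_char_minus_1: "norm (unit_char x - 1) = 2 * \<bar>sin (pi * x)\<bar>"
proof -
  have "cos (2 * (pi * x)) = 1 - 2 * (sin (pi * x))\<^sup>2" by (simp add: cos_double_sin)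
  moreover have "sin (2 * (pi * x)) = 2 * sin (pi * x) * cos (pi * x)" by (rule sin_double)
  moreover have "(2 * (sin (pi * x))\<^sup>2)\<^sup>2 + (2 * sin (pi * x) * cos (pi * x))\<^sup>2 =
      (2 * sin (pi * x))\<^sup>2 * ((sin (pi * x))\<^sup>2 + (cos (pi * x))\<^sup>2)"
    by (simp only: power2_eq_square) algebra
  ultimately have "(norm (unit_char x - 1))\<^sup>2 = (2 * sin (pi * x))\<^sup>2"
    by (simp add: unit_char_def cmod_power2 mult.assoc)
  then have "\<bar>norm (unit_char x - 1)\<bar> = \<bar>2 * sin (pi * x)\<bar>" unfolding power2_eq_iff abs_eq_iff .
  then show ?thesis by (simp add: abs_mult)
qed

text \<open>The right-hand side is the distance from \<open>x\<close> to the nearest integer. The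
  sharp constant would be 4; the constant 1 is enough and allows a crude estimate of the
  sine.\<close>

lemma norm_unit_char_minus_1_ge: "norm (unit_char x - 1) \<ge> \<bar>x - of_int (round x)\<bar>"
proof -
  define y where "y = \<bar>x - of_int (round x)\<bar>"
  have y: "0 \<le> y" "y \<le> 1 / 2"
    using of_int_round_abs_le[of x] by (auto simp: y_def abs_minus_commute)
  have "unit_char x = unit_char (x - of_int (round x))"
    using unit_char_add[of "x - of_int (round x)" "of_int (round x)"] by simp
  then have "norm (unit_char x - 1) = 2 * \<bar>sin (pi * (x - of_int (round x)))\<bar>"
    by (simp only: norm_unit_char_minus_1)
  also have "\<bar>sin (pi * (x - of_int (round x)))\<bar> = \<bar>sin (pi * y)\<bar>"
  proof -
    have "\<bar>sin (pi * z)\<bar> = \<bar>sin (pi * \<bar>z\<bar>)\<bar>" for z by (simp add: abs_if)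
    then show ?thesis unfolding y_def .
  qed
  also have "2 * \<bar>sin (pi * y)\<bar> \<ge> y"
  \<comment> \<open>Below \<open>1 / 3\<close> the mean value theorem applies with cosine at least
    \<open>1 / 2\<close>. From there up to \<open>1 / 2\<close> the sine is at least
    \<open>1 / 2\<close>, so its double is at least 1.\<close>
  proof (cases "y < 1 / 3")
    case True
    show ?thesis
    proof (cases "y = 0")
      case False
      then have "pi * y > 0" using y by simp
      then have "\<exists>z>0. z < pi * y \<and> sin (pi * y) - sin 0 = (pi * y - 0) * cos z"
        by (rule MVT2) (rule DERIV_sin)
      then obtain z where z: "0 < z" "z < pi * y" "sin (pi * y) - sin 0 = (pi * y - 0) * cos z"
        by blast
      have "pi * y < pi * (1 / 3)" using True by (intro mult_strict_left_mono) auto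
      then have "z < pi / 3" using z(2) by linarith
      then have "cos z \<ge> 1 / 2"
        using cos_monotone_0_pi_le[of z "pi / 3"] z(1) pi_gt_zero by (simp add: cos_60)
      then have "sin (pi * y) \<ge> pi * y * (1 / 2)"
        using mult_left_mono[of "1 / 2" "cos z" "pi * y"] z(3) \<open>pi * y > 0\<close> by simp
      moreover have "pi * y \<ge> 1 * y" using y pi_ge_two by (intro mult_right_mono) auto
      ultimately show ?thesis by linarith
    qed simp
  next
    case False
    have "sin (pi * y) \<ge> sin (pi / 6)"
    proof (rule sin_monotone_2pi_le)
      show "pi / 6 \<le> pi * y" using False pi_gt_zero by (simp add: field_simps)
      show "pi * y \<le> pi / 2" using y pi_gt_zero by (simp add: field_simps)
    qed (use pi_gt_zero in simp)
    then show ?thesis using y by (simp add: sin_30)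
  qed
  finally show ?thesis by (simp add: y_def)
qed

lemma norm_unit_char_minus_minus_1: "norm (unit_char (- x) - 1) = norm (unit_char x - 1)"
  by (simp add: norm_unit_char_minus_1)

text \<open>Multiplying the Diophantine inequality by \<open>q\<close>, with the integer nearest to
  \<open>q * \<alpha>\<close> as numerator, bounds the distance to the integers. The exponent is
  rounded up to a natural number so that ordinary powers suffice later.\<close>

lemma diophantine_small_divisors:
  assumes "diophantine \<alpha>"
  obtains c R where "c > 0"
    "\<And>q::nat. q \<ge> 1 \<Longrightarrow> norm (unit_char (real q * \<alpha>) - 1) \<ge> c / real q ^ R"
proof -
  obtain r C where r: "r > 1" and C: "C > 0"
    and D: "\<And>(p::int) (q::nat). q \<ge> 1 \<Longrightarrow> \<bar>\<alpha> - real_of_int p / real q\<bar> \<ge> C / real q powr (1 + r)"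
    using assms unfolding diophantine_def diophantine_type_def by blast
  define R where "R = nat \<lceil>r\<rceil>"
  have "norm (unit_char (real q * \<alpha>) - 1) \<ge> C / real q ^ R" if q: "q \<ge> 1" for q :: nat
  proof -
    let ?p = "round (real q * \<alpha>)"
    have q0: "real q > 0" using q by simp
    have "C / real q ^ R = C / real q powr real R" using q0 by (simp add: powr_realpow)
    also have "\<dots> \<le> C / real q powr r"
      using q C r by (intro divide_left_mono powr_mono mult_pos_pos) (auto simp: R_def)
    also have "\<dots> = real q * (C / real q powr (1 + r))" using q0 by (simp add: powr_add)
    also have "\<dots> \<le> real q * \<bar>\<alpha> - real_of_int ?p / real q\<bar>"
      using D[OF q] q0 by (intro mult_left_mono) auto
    also have "\<dots> = \<bar>real q * (\<alpha> - real_of_int ?p / real q)\<bar>" by (simp add: abs_mult)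
    also have "real q * (\<alpha> - real_of_int ?p / real q) = real q * \<alpha> - real_of_int ?p"
      using q0 by (simp add: field_simps)
    also have "\<bar>\<dots>\<bar> \<le> norm (unit_char (real q * \<alpha>) - 1)" by (rule norm_unit_char_minus_1_ge)
    finally show ?thesis .
  qed
  then show thesis using that C by blast
qed

section \<open>The values of \<open>g\<close> along the rotation, and the continuation\<close>

lemma iterated_difference_rotation:
  assumes \<alpha>: "diophantine \<alpha>" and g: "real_analytic g" and per: "\<And>x. g (x + 1) = g x"
    and int: "integral {0..1} g = 0"
  shows "iterated_difference (\<lambda>n. g (real (Suc n) * \<alpha>))"
proof -
  obtain c R where c: "c > 0"
    and D: "\<And>q::nat. q \<ge> 1 \<Longrightarrow> norm (unit_char (real q * \<alpha>) - 1) \<ge> c / real q ^ R"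
    using diophantine_small_divisors[OF \<alpha>] by metis
  obtain g' where g': "\<And>x. (g has_vector_derivative g' x) (at x)"
    using real_analytic_has_derivative[OF g] by metis
  \<comment> \<open>The sign \<sigma> separates positive from negative frequencies, giving two
    series indexed by the naturals.\<close>
  define h where "h \<sigma> m = \<sigma> * real (Suc m) * \<alpha>" for \<sigma> :: real and m
  \<comment> \<open>The sequence starts at \<open>g \<alpha>\<close> and not at \<open>g 0\<close>,
    so one character factor is absorbed into the coefficient.\<close>
  define b where "b \<sigma> m = fourier_coeff g (\<sigma> * int (Suc m)) * unit_char (h (of_int \<sigma>) m)" for \<sigma> m
  have Dh: "norm (unit_char (h (of_int \<sigma>) m) - 1) \<ge> c / real (Suc m) ^ R"
    if "\<sigma> = 1 \<or> \<sigma> = -1" for \<sigma> :: int and m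
    using D[of "Suc m"] norm_unit_char_minus_minus_1[of "real (Suc m) * \<alpha>"] that
    by (auto simp: h_def simp del: of_nat_Suc)
  have s: "summable (\<lambda>m. norm (b \<sigma> m) / norm (unit_char (h (of_int \<sigma>) m) - 1) ^ k)"
    if \<sigma>: "\<sigma> = 1 \<or> \<sigma> = -1" for \<sigma> k
  proof -
    \<comment> \<open>The part \<open>R * k\<close> of the exponent pays for the \<open>k\<close>-th
      power of the divisor; the remaining 2 makes the series converge.\<close>
    obtain A where A: "\<And>m. norm (fourier_coeff g m) * real_of_int \<bar>m\<bar> ^ (R * k + 2) \<le> A"
      using fourier_coeff_rapid_decay[OF g per] by metis
    have le: "norm (b \<sigma> m) / norm (unit_char (h (of_int \<sigma>) m) - 1) ^ k
        \<le> A / c ^ k * real (Suc m) powr (- 2)" for m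
    proof -
      have "real_of_int \<bar>\<sigma> * int (Suc m)\<bar> = real (Suc m)" using \<sigma> by auto
      then have "norm (b \<sigma> m) \<le> A / real (Suc m) ^ (R * k + 2)"
        using A[of "\<sigma> * int (Suc m)"] by (simp add: b_def norm_mult pos_le_divide_eq del: of_nat_Suc)
      moreover have "(c / real (Suc m) ^ R) ^ k \<le> norm (unit_char (h (of_int \<sigma>) m) - 1) ^ k"
        using c by (intro power_mono Dh \<sigma>) simp
      moreover have "(c / real (Suc m) ^ R) ^ k > 0" using c by simp
      ultimately have "norm (b \<sigma> m) / norm (unit_char (h (of_int \<sigma>) m) - 1) ^ k
          \<le> (A / real (Suc m) ^ (R * k + 2)) / (c / real (Suc m) ^ R) ^ k"
        by (intro frac_le) (auto intro: order_trans[OF norm_ge_zero])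
      also have "\<dots> = A / c ^ k * real (Suc m) powr (- 2)"
        by (simp add: power_divide power_add power_mult powr_minus field_simps power2_eq_square del: of_nat_Suc)
      finally show ?thesis .
    qed
    show ?thesis
    proof (rule summable_comparison_test')
      show "summable (\<lambda>m. A / c ^ k * real (Suc m) powr (- 2))"
        by (rule summable_mult, rule summable_Suc_powr) simp
      show "norm (norm (b \<sigma> m) / norm (unit_char (h (of_int \<sigma>) m) - 1) ^ k)
          \<le> A / c ^ k * real (Suc m) powr (- 2)" for m
        using le[of m] by (simp only: real_norm_def abs_of_nonneg divide_nonneg_nonneg
            zero_le_power norm_ge_zero)
    qed
  qed
  have sb: "summable (\<lambda>m. b \<sigma> m * unit_char (h (of_int \<sigma>) m) ^ n)" if "\<sigma> = 1 \<or> \<sigma> = -1" for \<sigma> n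
    by (rule summable_norm_cancel) (use s[OF that, of 0] in \<open>simp add: norm_mult norm_power\<close>)
  have it: "iterated_difference (\<lambda>n. \<Sum>m. b \<sigma> m * unit_char (h (of_int \<sigma>) m) ^ n)"
    if "\<sigma> = 1 \<or> \<sigma> = -1" for \<sigma>
  proof (rule iterated_difference_series)
    show "unit_char (h (of_int \<sigma>) m) \<noteq> 1" for m
    proof -
      have "0 < norm (unit_char (h (of_int \<sigma>) m) - 1)"
        by (rule less_le_trans[OF _ Dh[OF that]]) (simp add: c)
      then show ?thesis by auto
    qed
  qed (simp_all add: s that)
  have "g (real (Suc n) * \<alpha>) = (\<Sum>m. b 1 m * unit_char (h (of_int 1) m) ^ n) +
      (\<Sum>m. b (-1) m * unit_char (h (of_int (-1)) m) ^ n)" for n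
  proof -
    have b: "b \<sigma> m * unit_char (h (of_int \<sigma>) m) ^ n =
        fourier_coeff g (\<sigma> * int (Suc m)) * unit_char (of_int \<sigma> * real (Suc m) * (real (Suc n) * \<alpha>))" for \<sigma> m
    proof -
      have "unit_char (h (of_int \<sigma>) m) * unit_char (h (of_int \<sigma>) m) ^ n =
          unit_char (of_int \<sigma> * real (Suc m) * (real (Suc n) * \<alpha>))"
        by (simp add: unit_char_power unit_char_add[symmetric] h_def algebra_simps)
      then show ?thesis unfolding b_def mult.assoc by (rule arg_cong)
    qed
    \<comment> \<open>Frequency 0, whose divisor would vanish, is absent because \<open>g\<close>
      has mean zero.\<close>
    have "fourier_coeff g 0 = 0" using int by (simp add: fourier_coeff_def)
    then have "(\<lambda>m. b 1 m * unit_char (h (of_int 1) m) ^ n +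
        b (-1) m * unit_char (h (of_int (-1)) m) ^ n) sums g (real (Suc n) * \<alpha>)"
      using fourier_sums[OF g' per, of "real (Suc n) * \<alpha>"] unfolding b
      by (simp only: diff_zero mult_1 of_int_1 of_int_minus mult_minus1)
    moreover have "(\<lambda>m. b 1 m * unit_char (h (of_int 1) m) ^ n +
        b (-1) m * unit_char (h (of_int (-1)) m) ^ n) sums
        ((\<Sum>m. b 1 m * unit_char (h (of_int 1) m) ^ n) +
         (\<Sum>m. b (-1) m * unit_char (h (of_int (-1)) m) ^ n))"
      by (intro sums_add summable_sums sb) simp_all
    ultimately show ?thesis by (rule sums_unique2)
  qed
  then show ?thesis using iterated_difference_add[OF it[of 1] it[of "-1"]] by simp
qed

theorem theorem9:
  fixes \<alpha> :: real and g :: "real \<Rightarrow> complex"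
  assumes "diophantine \<alpha>"
    and "real_analytic g"
    and "\<And>x. g (x + 1) = g x"
    and "integral {0..1} g = 0"
  shows "(\<forall>s. Re s > 1 \<longrightarrow> summable (\<lambda>n. norm (zeta_term g \<alpha> s (Suc n)))) \<and>
    (\<exists>F :: complex \<Rightarrow> complex. F analytic_on UNIV \<and>
       (\<forall>s. Re s > 1 \<longrightarrow> F s = zeta_series g \<alpha> s))"
proof (intro conjI allI impI)
  let ?u = "\<lambda>n. g (real (Suc n) * \<alpha>)"
  have u: "iterated_difference ?u" by (rule iterated_difference_rotation[OF assms])
  have eq: "zeta_term g \<alpha> s (Suc n) = ?u n * powr_diff 0 s (real (Suc n))" for s n
    by (simp add: zeta_term_def powr_minus divide_inverse del: of_nat_Suc)
  show "summable (\<lambda>n. norm (zeta_term g \<alpha> s (Suc n)))" if "Re s > 1" for s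
  proof -
    \<comment> \<open>Order 0 of the difference property supplies the bound on the values of
      \<open>g\<close> that absolute convergence requires.\<close>
    obtain w where "bounded (range w)" "?u = (forward_diff ^^ 0) w"
      using u unfolding iterated_difference_def by blast
    then obtain B where B: "\<And>n. norm (?u n) \<le> B"
      unfolding bounded_iff by (metis funpow_0 rangeI)
    show ?thesis
    proof (rule summable_comparison_test')
      show "summable (\<lambda>n. B * real (Suc n) powr (- Re s))"
        using that by (intro summable_mult summable_Suc_powr)
      show "norm (norm (zeta_term g \<alpha> s (Suc n))) \<le> B * real (Suc n) powr (- Re s)" for n
        using B[of n] unfolding eq by (simp add: norm_mult norm_powr_real_powr mult_right_mono del: of_nat_Suc)
    qed
  qed
  show "\<exists>F. F analytic_on UNIV \<and> (\<forall>s. Re s > 1 \<longrightarrow> F s = zeta_series g \<alpha> s)"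
    using iterated_difference_dirichlet_extends[OF u] by (simp add: zeta_series_def dirichlet_def eq)
qed

end
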